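(* Let $G=(V,E)$ be a finite directed graph, $s\in V$, $V=V_1\cup V_2\cup V_T$ a partition where $V_T$ is exactly the set of vertices with no outgoing arcs, and $r_1,r_2:E\to\mathbb{R}$ with $r_i(e)>0$ for all $i\in\{1,2\}$, $e\in E$. Then $P_1\cap P_2\neq\emptyset$, where $P_1,P_2$ are defined below.
   Context: For $i\in\{1,2\}$, let $S_i$ be the set of mappings $\sigma_i$ assigning to each $u\in V_i$ an arc $(u,\sigma_i(u))\in E$. For $\sigma_1\in S_1$, let $G(\sigma_1)$ be the digraph obtained from $G$ by deleting, for each $v\in V_1$, all arcs leaving $v$ except $(v,\sigma_1(v))$. Let $P_2(\sigma_1)$ be the set of all directed paths from $s$ to (some vertex of) $V_T$ in $G(\sigma_1)$ minimizing $R_2(p)=\sum_{e\in p}r_2(e)$; if $G(\sigma_1)$ has no directed path from $s$ to $V_T$, set $P_2(\sigma_1)=\{\overline\infty\}$, where $\overline\infty$ is a special symbol. Let $P_2=\bigcup_{\sigma_1\in S_1}P_2(\sigma_1)$. Define $G(\sigma_2)$, $P_1(\sigma_2)$ (using $r_1$) and $P_1=\bigcup_{\sigma_2\in S_2}P_1(\sigma_2)$ symmetrically by swapping the indices 1 and 2. *)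

theory Defs
  imports Complex_Main "HOL-Library.FuncSet" "Graph_Theory.Pair_Digraph"
begin

text \<open>Arcs are ordered pairs of vertices, so there are no parallel arcs; loops are permitted.\<close>

definition strategies :: "'a pair_pre_digraph \<Rightarrow> 'a set \<Rightarrow> ('a \<Rightarrow> 'a) set" where
  "strategies G U = (\<Pi>\<^sub>E u\<in>U. {v. (u, v) \<in> parcs G})"

definition restrict_to_strategy ::
    "'a pair_pre_digraph \<Rightarrow> 'a set \<Rightarrow> ('a \<Rightarrow> 'a) \<Rightarrow> 'a pair_pre_digraph" where
  "restrict_to_strategy G U \<sigma> =
     \<lparr> pverts = pverts G, parcs = {(u, v) \<in> parcs G. u \<in> U \<longrightarrow> v = \<sigma> u} \<rparr>"

text \<open>
  A path is the list of its arcs and has pairwise distinct vertices. If the source already lies in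
  \<open>T\<close>, the empty list represents the trivial path.
\<close>

definition paths_to :: "'a pair_pre_digraph \<Rightarrow> 'a \<Rightarrow> 'a set \<Rightarrow> ('a \<times> 'a) awalk set" where
  "paths_to G s T = {p. \<exists>t\<in>T. pre_digraph.apath (with_proj G) s p t}"

definition path_cost :: "('a \<times> 'a \<Rightarrow> real) \<Rightarrow> ('a \<times> 'a) awalk \<Rightarrow> real" where
  "path_cost r p = (\<Sum>e\<leftarrow>p. r e)"

text \<open>\<open>Infinity\<close> is the special symbol for the case that \<open>T\<close> cannot be reached from \<open>s\<close>.\<close>

datatype 'a outcome = Path "('a \<times> 'a) awalk" | Infinity

definition shortest_outcomes ::
    "'a pair_pre_digraph \<Rightarrow> 'a \<Rightarrow> 'a set \<Rightarrow> ('a \<times> 'a \<Rightarrow> real) \<Rightarrow> 'a outcome set" where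
  "shortest_outcomes G s T r =
     (if paths_to G s T = {} then {Infinity}
      else Path ` {p. is_arg_min (path_cost r) (\<lambda>q. q \<in> paths_to G s T) p})"

text \<open>
  Here \<open>U\<close> is the set of vertices controlled by the opponent of the player whose costs are \<open>r\<close>:
  \<open>P\<^sub>2\<close> is obtained from \<open>V\<^sub>1\<close> and \<open>r\<^sub>2\<close>, and \<open>P\<^sub>1\<close> from \<open>V\<^sub>2\<close> and \<open>r\<^sub>1\<close>.
\<close>

definition best_response_outcomes ::
    "'a pair_pre_digraph \<Rightarrow> 'a \<Rightarrow> 'a set \<Rightarrow> 'a set \<Rightarrow> ('a \<times> 'a \<Rightarrow> real) \<Rightarrow> 'a outcome set" where
  "best_response_outcomes G s T U r =
     (\<Union>\<sigma>\<in>strategies G U. shortest_outcomes (restrict_to_strategy G U \<sigma>) s T r)"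

end

theory Submission
  imports Defs
begin

text \<open>
  Consider the zero-sum game in which player 1 minimises the \<open>r\<^sub>1\<close>-cost of reaching a terminal and
  player 2 maximises it. Let \<open>W\<close> be the set of vertices where the value \<open>d\<close> is finite, and suppose
  \<open>s \<in> W\<close>. Let \<open>\<sigma>\<close> be a uniformly optimal strategy of player 1 and \<open>p\<close> an \<open>r\<^sub>2\<close>-shortest path in
  \<open>G(\<sigma>)\<close>. The reduced costs \<open>r\<^sub>1(x,y) + d(y) - d(x)\<close> are nonpositive on the arcs of \<open>p\<close>. Let player 2
  follow \<open>p\<close> on \<open>p\<close> and play optimally elsewhere. Every path to a terminal in the resulting
  graph stays in \<open>W\<close>, has nonnegative reduced costs off \<open>p\<close>, and uses each arc of \<open>p\<close> at most once,
  so it costs at least as much as \<open>p\<close>. Hence \<open>p \<in> P\<^sub>1 \<inter> P\<^sub>2\<close>. The case where player 2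
  can force reaching a terminal is symmetric. If neither player can, each can cut off the terminals
  from \<open>s\<close>, and the symbol for infinity is a common outcome.
\<close>

section \<open>Paths as arc lists, and graphs restricted to a strategy\<close>

lemma apath_with_proj_iff:
  "pre_digraph.apath (with_proj G) u p v \<longleftrightarrow>
     u \<in> pverts G \<and> set p \<subseteq> parcs G \<and> pcas u p v \<and> distinct (pawalk_verts u p)"
  by (simp add: pre_digraph.apath_def pre_digraph.awalk_def cas_with_proj_eq
      awalk_verts_with_proj_eq)

text \<open>The tails are the visited vertices without the last one. Hence a path is a finite map
  from tails to heads and repeats no arc, so its cost is a sum over a set.\<close>

lemma distinct_pawalk_verts_tails: "distinct (pawalk_verts u p) \<Longrightarrow> distinct (map fst p)"
proof -
  have "\<exists>v. pawalk_verts u p = map fst p @ [v]"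
    by (induction p arbitrary: u) auto
  then show "distinct (pawalk_verts u p) \<Longrightarrow> distinct (map fst p)"
    by auto
qed

text \<open>Reduced costs shift the cost of all paths with the same \<open>d\<close> at both ends by
  one constant, so they compare such paths as \<open>r\<close> does.\<close>

lemma path_cost_telescope:
  fixes d :: "'a \<Rightarrow> real"
  shows "pcas u p v \<Longrightarrow>
    path_cost (\<lambda>e. r e + d (snd e) - d (fst e)) p = path_cost r p + d v - d u"
  unfolding path_cost_def by (induction p arbitrary: u) auto

lemma pcas_closed_backwards:
  assumes "pcas u p v" "v \<in> W" "\<And>x y. (x, y) \<in> set p \<Longrightarrow> y \<in> W \<Longrightarrow> x \<in> W"
  shows "u \<in> W \<and> (\<forall>(x, y)\<in>set p. x \<in> W \<and> y \<in> W)"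
  using assms
proof (induction p arbitrary: u)
  case (Cons e p)
  obtain x y where e: "e = (x, y)" by (cases e)
  have "y \<in> W \<and> (\<forall>(x, y)\<in>set p. x \<in> W \<and> y \<in> W)"
    using Cons.prems e by (intro Cons.IH) auto
  moreover have "x \<in> W"
    using Cons.prems(3)[of x y] e calculation by auto
  ultimately show ?case using Cons.prems(1) e by auto
qed auto

lemma pcas_closed_forwards:
  assumes "pcas u p v" "u \<in> W" "\<And>x y. (x, y) \<in> set p \<Longrightarrow> x \<in> W \<Longrightarrow> y \<in> W"
  shows "\<forall>(x, y)\<in>set p. x \<in> W \<and> y \<in> W"
  using assms
proof (induction p arbitrary: u)
  case (Cons e p)
  obtain x y where e: "e = (x, y)" by (cases e)
  have x: "x \<in> W" "pcas y p v" using Cons.prems e by auto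
  then have y: "y \<in> W" using Cons.prems(3)[of x y] e by auto
  have "\<forall>(x, y)\<in>set p. x \<in> W \<and> y \<in> W"
    using x y Cons.prems(3) by (intro Cons.IH[of y]) auto
  then show ?case using x y e by auto
qed auto

lemma pair_fin_digraph_restrict_to_strategy:
  assumes "pair_fin_digraph G"
  shows "pair_fin_digraph (restrict_to_strategy G U \<sigma>)"
proof -
  interpret pair_fin_digraph G by fact
  have "parcs (restrict_to_strategy G U \<sigma>) \<subseteq> parcs G"
    by (auto simp: restrict_to_strategy_def)
  with pair_finite_arcs show ?thesis
    by unfold_locales
      (auto simp: restrict_to_strategy_def pair_finite_verts dest: in_arcsD1 in_arcsD2
        intro: finite_subset)
qed

lemma finite_paths_to:
  assumes "pair_fin_digraph G"
  shows "finite (paths_to G s T)"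
proof -
  interpret pair_fin_digraph G by fact
  have "paths_to G s T \<subseteq> (\<lambda>(u, p, v). p) ` {(u, p, v). apath u p v}"
    unfolding paths_to_def by force
  then show ?thesis
    using apaths_finite_triple finite_surj by blast
qed

lemma restrict_strategy_arc_iff:
  "(u, v) \<in> parcs (restrict_to_strategy G U \<sigma>) \<longleftrightarrow> (u, v) \<in> parcs G \<and> (u \<in> U \<longrightarrow> v = \<sigma> u)"
  by (simp add: restrict_to_strategy_def)

lemma pverts_restrict_to_strategy [simp]: "pverts (restrict_to_strategy G U \<sigma>) = pverts G"
  by (simp add: restrict_to_strategy_def)

section \<open>Game values on the winning region, built in Dijkstra order\<close>

text \<open>\<open>A\<close> belongs to the player minimising \<open>r\<close>, \<open>B\<close> to the maximising opponent.\<close>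

locale cost_game = pair_fin_digraph G for G :: "'a pair_pre_digraph" +
  fixes A B T :: "'a set" and r :: "'a \<times> 'a \<Rightarrow> real"
  assumes verts_eq: "pverts G = A \<union> B \<union> T"
    and disjoint: "A \<inter> B = {}" "A \<inter> T = {}" "B \<inter> T = {}"
    and terminals_eq: "T = {v \<in> pverts G. out_arcs (with_proj G) v = {}}"
    and cost_pos: "e \<in> parcs G \<Longrightarrow> r e > 0"
begin

lemma successor_exists:
  assumes "x \<in> A \<union> B"
  shows "\<exists>y. (x, y) \<in> parcs G"
proof -
  have "x \<in> pverts G" "x \<notin> T"
    using assms verts_eq disjoint by auto
  then have "out_arcs (with_proj G) x \<noteq> {}"
    using terminals_eq by blast
  then show ?thesis by auto
qed

lemma terminal_no_arc: "x \<in> T \<Longrightarrow> (x, y) \<notin> parcs G"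
  using terminals_eq by (auto simp: out_arcs_def)

definition options :: "'a set \<Rightarrow> ('a \<Rightarrow> real) \<Rightarrow> 'a \<Rightarrow> real set" where
  "options W d x = (\<lambda>y. r (x, y) + d y) ` {y \<in> W. (x, y) \<in> parcs G}"

text \<open>One step of the attractor construction: the minimiser can, or the opponent must, move
  into \<open>W\<close>.\<close>

definition ready :: "'a set \<Rightarrow> 'a \<Rightarrow> bool" where
  "ready W x \<longleftrightarrow> x \<in> A \<and> (\<exists>y\<in>W. (x, y) \<in> parcs G) \<or> x \<in> B \<and> (\<forall>y. (x, y) \<in> parcs G \<longrightarrow> y \<in> W)"

definition offer :: "'a set \<Rightarrow> ('a \<Rightarrow> real) \<Rightarrow> 'a \<Rightarrow> real" where
  "offer W d x = (if x \<in> A then Min (options W d x) else Max (options W d x))"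

text \<open>\<open>d\<close> solves the Bellman equations on \<open>W\<close>, looking only at arcs
  into \<open>W\<close>. Readiness keeps the minima and maxima from ranging over the empty
  set.\<close>

definition potential :: "'a set \<Rightarrow> ('a \<Rightarrow> real) \<Rightarrow> bool" where
  "potential W d \<longleftrightarrow> T \<subseteq> W \<and> W \<subseteq> pverts G \<and> (\<forall>x\<in>T. d x = 0) \<and>
     (\<forall>x\<in>W - T. ready W x \<and> d x = offer W d x)"

text \<open>
  The invariant of Dijkstra's algorithm: vertices enter \<open>W\<close> in order of increasing value, so a new
  vertex never improves the options of an old one.
\<close>

definition frontier_above :: "'a set \<Rightarrow> ('a \<Rightarrow> real) \<Rightarrow> bool" where
  "frontier_above W d \<longleftrightarrow> (\<forall>x\<in>pverts G - W. ready W x \<longrightarrow> (\<forall>z\<in>W. d z \<le> offer W d x))"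

lemma options_finite: "finite (options W d x)"
proof -
  have "{y \<in> W. (x, y) \<in> parcs G} \<subseteq> pverts G"
    using in_arcsD2 by blast
  then show ?thesis
    unfolding options_def using pair_finite_verts finite_subset by blast
qed

lemma options_nonempty: "ready W x \<Longrightarrow> options W d x \<noteq> {}"
  using successor_exists[of x] by (auto simp: ready_def options_def)

lemma ready_notin_T: "ready W x \<Longrightarrow> x \<notin> T"
  using disjoint by (auto simp: ready_def)

lemma options_extend:
  assumes "x0 \<notin> W"
  shows "options (insert x0 W) (d(x0 := c)) x =
    (if (x, x0) \<in> parcs G then insert (r (x, x0) + c) (options W d x) else options W d x)"
proof -
  have "{y \<in> insert x0 W. (x, y) \<in> parcs G} =
      (if (x, x0) \<in> parcs G then insert x0 {y \<in> W. (x, y) \<in> parcs G} else {y \<in> W. (x, y) \<in> parcs G})"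
    by auto
  moreover have "(\<lambda>y. r (x, y) + (d(x0 := c)) y) ` {y \<in> W. (x, y) \<in> parcs G} = options W d x"
    unfolding options_def using assms by (intro image_cong) auto
  ultimately show ?thesis
    by (simp add: options_def)
qed

text \<open>A ready vertex of \<open>B\<close> has all its arcs in \<open>W\<close>, so it gains no
  option. A vertex of \<open>A\<close> may gain one, but its value exceeds \<open>c\<close> and
  cannot lower the minimum.\<close>

lemma offer_extend:
  assumes "x0 \<notin> W" "ready W x" "offer W d x \<le> c"
  shows "offer (insert x0 W) (d(x0 := c)) x = offer W d x"
proof (cases "(x, x0) \<in> parcs G")
  case True
  then have "x \<in> A" using assms by (auto simp: ready_def)
  moreover have "offer W d x \<le> r (x, x0) + c"
    using assms(3) cost_pos[OF True] by simp
  moreover have "Min (insert v (options W d x)) = min v (Min (options W d x))" for v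
    using options_finite options_nonempty[OF assms(2)] by (rule Min_insert)
  ultimately show ?thesis
    using True assms(1) by (simp add: offer_def options_extend min_absorb2)
qed (simp add: offer_def options_extend assms)

text \<open>The Dijkstra step: a ready vertex with the least offer joins \<open>W\<close>, and that
  offer becomes its value.\<close>

lemma potential_extend:
  assumes "potential W d" "frontier_above W d" "x \<in> pverts G - W" "ready W x"
  shows "\<exists>W' d'. potential W' d' \<and> frontier_above W' d' \<and> W \<subset> W'"
proof -
  define C where "C = {x \<in> pverts G - W. ready W x}"
  have "finite C" "C \<noteq> {}"
    using assms pair_finite_verts by (auto simp: C_def)
  then obtain x0 where x0: "x0 \<in> C" and least: "\<And>y. y \<in> C \<Longrightarrow> offer W d x0 \<le> offer W d y"
    using arg_min_if_finite[of C "offer W d"] by (metis not_le)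
  define c where "c = offer W d x0"
  define W' where "W' = insert x0 W"
  define d' where "d' = d(x0 := c)"
  have x0': "x0 \<notin> W" "ready W x0" "x0 \<in> pverts G" "x0 \<notin> T"
    using x0 ready_notin_T by (auto simp: C_def)
  have d_le: "d z \<le> c" if "z \<in> W" for z
    using assms(2) that x0' by (auto simp: frontier_above_def c_def)
  have d'_le: "d' z \<le> c" if "z \<in> W'" for z
    using d_le that by (auto simp: d'_def W'_def)
  have "ready W' z \<and> d' z = offer W' d' z" if z: "z \<in> W' - T" for z
  proof (cases "z = x0")
    case True
    \<comment> \<open>A loop at \<open>x0\<close> is harmless: \<open>offer_extend\<close> applies
      to \<open>x0\<close> itself.\<close>
    then show ?thesis
      using x0' offer_extend[of x0 W x0 d c]
      by (auto simp: ready_def c_def d'_def W'_def)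
  next
    case False
    then have "z \<in> W" "ready W z" "d z = offer W d z"
      using z assms(1) by (auto simp: potential_def W'_def)
    then show ?thesis
      using False offer_extend[of x0 W z d c] d_le[of z] x0'
      by (auto simp: ready_def d'_def W'_def)
  qed
  then have "potential W' d'"
    using assms(1) x0' by (auto simp: potential_def W'_def d'_def)
  moreover have "c \<le> offer W' d' y" if y: "y \<in> pverts G - W'" "ready W' y" for y
  proof (cases "y \<in> A")
    case True
    \<comment> \<open>An old option shows that \<open>y\<close> was ready before, so the choice of
      \<open>x0\<close> bounds its offer below by \<open>c\<close>.\<close>
    have "c \<le> v" if v: "v \<in> options W d y" for v
    proof -
      have "ready W y" using v True by (auto simp: ready_def options_def)
      then have "c \<le> offer W d y" using least[of y] y by (auto simp: C_def c_def W'_def)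
      also have "\<dots> \<le> v" using True v options_finite by (simp add: offer_def)
      finally show ?thesis .
    qed
    moreover have "c \<le> r (y, x0) + c" if "(y, x0) \<in> parcs G"
      using cost_pos[OF that] by simp
    ultimately have "c \<le> v" if "v \<in> options W' d' y" for v
      using that x0' by (auto simp: W'_def d'_def options_extend split: if_splits)
    then show ?thesis
      using True options_finite options_nonempty[OF y(2)] by (simp add: offer_def)
  next
    case False
    show ?thesis
    \<comment> \<open>For \<open>y\<close> in \<open>B\<close>, an arc to \<open>x0\<close> alone
      pushes the maximum above \<open>c\<close>; without it \<open>y\<close> was ready
      before.\<close>
    proof (cases "(y, x0) \<in> parcs G")
      case True
      then have "c \<le> r (y, x0) + c" using cost_pos by (simp add: less_imp_le)
      moreover have "r (y, x0) + c \<in> options W' d' y"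
        using True x0' by (simp add: W'_def d'_def options_extend)
      then have "r (y, x0) + c \<le> offer W' d' y"
        using False options_finite by (simp add: offer_def)
      ultimately show ?thesis by linarith
    next
      case arc: False
      then have "ready W y" using False y by (auto simp: ready_def W'_def)
      then have "c \<le> offer W d y" using least[of y] y by (auto simp: C_def c_def W'_def)
      then show ?thesis
        using arc False x0' by (simp add: offer_def W'_def d'_def options_extend)
    qed
  qed
  then have "frontier_above W' d'"
    using d'_le order_trans unfolding frontier_above_def by blast
  moreover have "W \<subset> W'"
    using x0' by (auto simp: W'_def)
  ultimately show ?thesis by blast
qed

text \<open>Extension starts from \<open>T\<close> with value 0 and stops because the finite
  complement of \<open>W\<close> shrinks each time.\<close>

lemma maximal_potential_exists:
  obtains W d where "potential W d" "\<And>x. x \<in> pverts G - W \<Longrightarrow> \<not> ready W x"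
proof -
  have "\<exists>W d. potential W d \<and> frontier_above W d \<and> (\<forall>x\<in>pverts G - W. \<not> ready W x)"
    if "potential W d" "frontier_above W d" for W d
    using that
  proof (induction "card (pverts G - W)" arbitrary: W d rule: less_induct)
    case less
    show ?case
    proof (cases "\<exists>x\<in>pverts G - W. ready W x")
      case True
      then obtain x where "x \<in> pverts G - W" "ready W x" by blast
      from potential_extend[OF less.prems this]
      obtain W' d' where W': "potential W' d'" "frontier_above W' d'" "W \<subset> W'"
        by blast
      then have "pverts G - W' \<subset> pverts G - W"
        by (auto simp: potential_def)
      then have "card (pverts G - W') < card (pverts G - W)"
        using pair_finite_verts by (simp add: psubset_card_mono)
      then show ?thesis using less.hyps[OF _ W'(1,2)] by simp
    qed (use less.prems in blast)
  qed
  moreover have "potential T (\<lambda>_. 0)"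
    using verts_eq by (auto simp: potential_def)
  moreover have "frontier_above T (\<lambda>_. 0)"
    unfolding frontier_above_def
  proof (intro ballI impI)
    fix x z assume x: "x \<in> pverts G - T" "ready T x"
    have "0 \<le> v" if "v \<in> options T (\<lambda>_. 0) x" for v
      using that cost_pos by (auto simp: options_def less_imp_le)
    moreover have "offer T (\<lambda>_. 0) x \<in> options T (\<lambda>_. 0) x"
      using options_finite options_nonempty[OF x(2)] by (simp add: offer_def)
    ultimately show "0 \<le> offer T (\<lambda>_. 0) x" by blast
  qed
  ultimately have "\<exists>W d. potential W d \<and> frontier_above W d \<and> (\<forall>x\<in>pverts G - W. \<not> ready W x)"
    by simp
  then show ?thesis using that by metis
qed

section \<open>Optimal strategies read off a maximal potential\<close>

lemma potential_step:
  assumes "potential W d" "x \<in> W - T"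
  shows "\<exists>y\<in>W. (x, y) \<in> parcs G \<and> d x = r (x, y) + d y"
proof -
  have "d x \<in> options W d x"
    using assms options_finite options_nonempty[of W x] by (auto simp: potential_def offer_def)
  then show ?thesis by (auto simp: options_def)
qed

lemma potential_A_le:
  assumes "potential W d" "x \<in> A" "x \<in> W" "y \<in> W" "(x, y) \<in> parcs G"
  shows "d x \<le> r (x, y) + d y"
proof -
  have "d x = offer W d x" using assms disjoint by (auto simp: potential_def)
  then show ?thesis using assms options_finite by (auto simp: offer_def options_def)
qed

lemma potential_B_ge:
  assumes "potential W d" "x \<in> B" "x \<in> W" "(x, y) \<in> parcs G"
  shows "y \<in> W" "r (x, y) + d y \<le> d x"
proof -
  have *: "d x = offer W d x" "ready W x" "x \<notin> A" using assms disjoint by (auto simp: potential_def)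
  then show "y \<in> W" using assms by (auto simp: ready_def)
  then have "r (x, y) + d y \<in> options W d x" using assms by (auto simp: options_def)
  then show "r (x, y) + d y \<le> d x" using * options_finite by (auto simp: offer_def)
qed

lemma optimal_strategies_exist:
  obtains W d \<sigma> \<tau> where "potential W d"
    "\<And>x. x \<in> pverts G - W \<Longrightarrow> \<not> ready W x"
    "\<sigma> \<in> strategies G A" "\<tau> \<in> strategies G B"
    "\<And>x. x \<in> A \<Longrightarrow> x \<in> W \<Longrightarrow> \<sigma> x \<in> W \<and> d x = r (x, \<sigma> x) + d (\<sigma> x)"
    "\<And>x. x \<in> B \<Longrightarrow> x \<in> W \<Longrightarrow> \<tau> x \<in> W \<and> d x = r (x, \<tau> x) + d (\<tau> x)"
    "\<And>x. x \<in> B \<Longrightarrow> x \<notin> W \<Longrightarrow> \<tau> x \<notin> W"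
proof -
  obtain W d where W: "potential W d" "\<And>x. x \<in> pverts G - W \<Longrightarrow> \<not> ready W x"
    using maximal_potential_exists by blast
  \<comment> \<open>Inside \<open>W\<close> some arc attains the Bellman value; outside, a vertex of
    \<open>B\<close> that is not ready has an arc avoiding \<open>W\<close>.\<close>
  have "\<exists>y. (x, y) \<in> parcs G \<and> (x \<in> W \<longrightarrow> y \<in> W \<and> d x = r (x, y) + d y) \<and>
      (x \<in> B \<longrightarrow> x \<notin> W \<longrightarrow> y \<notin> W)" if "x \<in> A \<union> B" for x
  proof (cases "x \<in> W")
    case True
    then show ?thesis using potential_step[OF W(1), of x] that disjoint by blast
  next
    case False
    then have "\<not> ready W x" using W(2) that verts_eq by auto
    then show ?thesis using False successor_exists[OF that] by (auto simp: ready_def)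
  qed
  then obtain f where f: "\<And>x. x \<in> A \<union> B \<Longrightarrow> (x, f x) \<in> parcs G \<and>
      (x \<in> W \<longrightarrow> f x \<in> W \<and> d x = r (x, f x) + d (f x)) \<and> (x \<in> B \<longrightarrow> x \<notin> W \<longrightarrow> f x \<notin> W)"
    by metis
  show ?thesis
    by (rule that[of W d "restrict f A" "restrict f B"]) (use W f in \<open>auto simp: strategies_def\<close>)
qed

text \<open>Under \<sigma>, costs being positive, \<open>d\<close> drops strictly along every
  available arc from \<open>W\<close>, so play cannot cycle there.\<close>

lemma path_reaches_terminal:
  assumes "potential W d" "s \<in> W"
    and \<sigma>: "\<sigma> \<in> strategies G A"
      "\<And>x. x \<in> A \<Longrightarrow> x \<in> W \<Longrightarrow> \<sigma> x \<in> W \<and> d x = r (x, \<sigma> x) + d (\<sigma> x)"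
  shows "paths_to (restrict_to_strategy G A \<sigma>) s T \<noteq> {}"
proof -
  let ?H = "restrict_to_strategy G A \<sigma>"
  interpret H: pair_fin_digraph ?H
    by (rule pair_fin_digraph_restrict_to_strategy) unfold_locales
  define N where "N = {x \<in> W. \<not> (\<exists>t\<in>T. x \<rightarrow>\<^sup>*\<^bsub>with_proj ?H\<^esub> t)}"
  have "W \<subseteq> pverts G" using assms by (simp add: potential_def)
  moreover have "N \<subseteq> W" by (auto simp: N_def)
  ultimately have "finite N" using pair_finite_verts by (meson finite_subset)
  have "N = {}"
  proof (rule ccontr)
    \<comment> \<open>A vertex of \<open>N\<close> with least \<open>d\<close> has a successor of
      smaller \<open>d\<close>, which therefore reaches \<open>T\<close>.\<close>
    assume "N \<noteq> {}"
    then obtain x where x: "x \<in> N" and least: "\<And>y. y \<in> N \<Longrightarrow> d x \<le> d y"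
      using arg_min_if_finite[of N d] \<open>finite N\<close> by (metis not_le)
    have "x \<rightarrow>\<^sup>*\<^bsub>with_proj ?H\<^esub> x"
      using x \<open>W \<subseteq> pverts G\<close> by (intro H.reachable_refl) (auto simp: N_def)
    then have "x \<notin> T" using x by (auto simp: N_def)
    then have xW: "x \<in> W" "x \<in> A \<union> B"
      using x verts_eq \<open>W \<subseteq> pverts G\<close> by (auto simp: N_def)
    obtain y where y: "(x, y) \<in> parcs ?H" "y \<in> W" "r (x, y) + d y \<le> d x"
    proof (cases "x \<in> A")
      case True
      then have "(x, \<sigma> x) \<in> parcs G" using \<sigma>(1) by (auto simp: strategies_def)
      then show ?thesis
        using that[of "\<sigma> x"] True \<sigma>(2)[of x] xW by (auto simp: restrict_strategy_arc_iff)
    next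
      case False
      obtain y where "(x, y) \<in> parcs G" using successor_exists xW by blast
      then show ?thesis
        using that[of y] False xW potential_B_ge[OF assms(1), of x y]
        by (auto simp: restrict_strategy_arc_iff)
    qed
    then have "d y < d x"
      using cost_pos[of "(x, y)"] by (auto simp: restrict_strategy_arc_iff)
    then have "y \<notin> N" using least by force
    then obtain t where t: "t \<in> T" "y \<rightarrow>\<^sup>*\<^bsub>with_proj ?H\<^esub> t" using y by (auto simp: N_def)
    then have "x \<rightarrow>\<^sup>*\<^bsub>with_proj ?H\<^esub> t"
      using H.adj_reachable_trans[of x y t] y(1) by simp
    then show False using x \<open>t \<in> T\<close> by (auto simp: N_def)
  qed
  then obtain t where "t \<in> T" "s \<rightarrow>\<^sup>*\<^bsub>with_proj ?H\<^esub> t"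
    using assms(2) by (auto simp: N_def)
  then show ?thesis
    using H.reachable_apath by (auto simp: paths_to_def)
qed

section \<open>Common outcomes of the two best-response problems\<close>

lemma mem_paths_to_iff:
  "p \<in> paths_to (restrict_to_strategy G U \<sigma>) s T \<longleftrightarrow>
     s \<in> pverts G \<and> (\<forall>(x, y)\<in>set p. (x, y) \<in> parcs G \<and> (x \<in> U \<longrightarrow> y = \<sigma> x)) \<and>
     (\<exists>t\<in>T. pcas s p t) \<and> distinct (pawalk_verts s p)"
  by (auto simp: paths_to_def apath_with_proj_iff restrict_to_strategy_def)

lemma terminal_common_outcome:
  assumes "potential W d" "\<And>x. x \<in> pverts G - W \<Longrightarrow> \<not> ready W x" "s \<in> W"
    and \<sigma>: "\<sigma> \<in> strategies G A"
      "\<And>x. x \<in> A \<Longrightarrow> x \<in> W \<Longrightarrow> \<sigma> x \<in> W \<and> d x = r (x, \<sigma> x) + d (\<sigma> x)"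
    and \<tau>: "\<tau> \<in> strategies G B"
      "\<And>x. x \<in> B \<Longrightarrow> x \<in> W \<Longrightarrow> \<tau> x \<in> W \<and> d x = r (x, \<tau> x) + d (\<tau> x)"
      "\<And>x. x \<in> B \<Longrightarrow> x \<notin> W \<Longrightarrow> \<tau> x \<notin> W"
  shows "best_response_outcomes G s T B r \<inter> best_response_outcomes G s T A r' \<noteq> {}"
proof -
  let ?P = "paths_to (restrict_to_strategy G A \<sigma>) s T"
  have "?P \<noteq> {}" using path_reaches_terminal assms by blast
  moreover have "finite ?P"
    by (intro finite_paths_to pair_fin_digraph_restrict_to_strategy) unfold_locales
  ultimately obtain p where p: "is_arg_min (path_cost r') (\<lambda>q. q \<in> ?P) p"
    using ex_is_arg_min_if_finite by blast
  then have pP: "p \<in> ?P" by (simp add: is_arg_min_def)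
  then have "Path p \<in> best_response_outcomes G s T A r'"
    using p \<sigma>(1) by (auto simp: best_response_outcomes_def shortest_outcomes_def)
  moreover
  \<comment> \<open>The opponent follows \<open>p\<close> at its tails and \<tau> elsewhere;
    \<open>map_of p\<close> is unambiguous because the tails are distinct.\<close>
  define \<rho> where "\<rho> = restrict (\<lambda>x. case map_of p x of Some y \<Rightarrow> y | None \<Rightarrow> \<tau> x) B"
  have p_arcs: "(x, y) \<in> parcs G" "x \<in> A \<Longrightarrow> y = \<sigma> x" if "(x, y) \<in> set p" for x y
    using that pP by (auto simp: mem_paths_to_iff)
  obtain t where t: "t \<in> T" "pcas s p t" and dist: "distinct (map fst p)"
    using pP distinct_pawalk_verts_tails[of s p] unfolding mem_paths_to_iff by blast
  have \<rho>_on: "\<rho> x = y" if "(x, y) \<in> set p" "x \<in> B" for x y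
    using that dist by (simp add: \<rho>_def)
  have \<rho>_off: "\<rho> x = \<tau> x" if "x \<in> B" "\<And>y. (x, y) \<notin> set p" for x
    using that by (auto simp: \<rho>_def split: option.splits dest: map_of_SomeD)
  have \<rho>: "\<rho> \<in> strategies G B"
    using \<tau>(1) p_arcs(1)[OF map_of_SomeD]
    by (fastforce simp: strategies_def \<rho>_def PiE_iff split: option.splits)
  let ?Q = "paths_to (restrict_to_strategy G B \<rho>) s T"
  let ?c = "\<lambda>e. r e + d (snd e) - d (fst e)"
  have pQ: "p \<in> ?Q"
    using pP \<rho>_on unfolding mem_paths_to_iff by auto
  have not_T: "x \<notin> T" if "(x, y) \<in> parcs G" for x y
    using terminal_no_arc that by blast
  have p_in_W: "\<forall>(x, y)\<in>set p. x \<in> W \<and> y \<in> W"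
  proof (rule pcas_closed_forwards[OF t(2) assms(3)])
    fix x y assume "(x, y) \<in> set p" "x \<in> W"
    then show "y \<in> W"
      using p_arcs[of x y] \<sigma>(2)[of x] potential_B_ge(1)[OF assms(1), of x y] verts_eq
        in_arcsD1[of x y] not_T[of x y] by auto
  qed
  \<comment> \<open>Equality holds at \<open>A\<close>, where \<open>p\<close> follows \<sigma>; at
    \<open>B\<close> the value is a maximum over all arcs.\<close>
  have p_le: "?c e \<le> 0" if "e \<in> set p" for e
  proof (cases e)
    case (Pair x y)
    then show ?thesis
      using that p_arcs[of x y] \<sigma>(2)[of x] potential_B_ge(2)[OF assms(1), of x y] verts_eq
        in_arcsD1[of x y] not_T[of x y] p_in_W by auto
  qed
  have "path_cost r p \<le> path_cost r q" if q: "q \<in> ?Q" for q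
  proof -
    have q_arcs: "(x, y) \<in> parcs G" "x \<in> B \<Longrightarrow> y = \<rho> x" if "(x, y) \<in> set q" for x y
      using that q by (auto simp: mem_paths_to_iff)
    obtain t' where t': "t' \<in> T" "pcas s q t'" and distq: "distinct (map fst q)"
      using q distinct_pawalk_verts_tails[of s q] unfolding mem_paths_to_iff by blast
    have "t' \<in> W" using t' assms(1) by (auto simp: potential_def)
    \<comment> \<open>Backwards from the terminal: outside \<open>W\<close>, no vertex of
      \<open>A\<close> has an arc into \<open>W\<close>, and a vertex of \<open>B\<close> is off
      \<open>p\<close> and follows \<tau>, which stays outside.\<close>
    have q_in_W: "\<forall>(x, y)\<in>set q. x \<in> W \<and> y \<in> W"
    proof (rule conjunct2[OF pcas_closed_backwards[OF t'(2) \<open>t' \<in> W\<close>]])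
      fix x y assume xy: "(x, y) \<in> set q" "y \<in> W"
      show "x \<in> W"
      proof (rule ccontr)
        assume "x \<notin> W"
        then have "\<not> ready W x" using assms(2) in_arcsD1 q_arcs(1)[OF xy(1)] by blast
        then have "x \<in> B"
          using xy q_arcs(1)[OF xy(1)] verts_eq in_arcsD1[of x y] not_T[of x y]
          by (auto simp: ready_def)
        moreover have "(x, z) \<notin> set p" for z using p_in_W \<open>x \<notin> W\<close> by auto
        ultimately show False
          using \<rho>_off \<tau>(3) \<open>x \<notin> W\<close> q_arcs(2)[OF xy(1)] xy(2) by auto
      qed
    qed
    \<comment> \<open>At \<open>A\<close> the value is a minimum. At \<open>B\<close> an arc off
      \<open>p\<close> can only come from \<tau>, which gives equality.\<close>
    have q_ge: "?c e \<ge> 0" if "e \<in> set q - set p" for e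
    proof (cases e)
      case (Pair x y)
      then have xy: "(x, y) \<in> set q" "(x, y) \<notin> set p" "x \<in> W" "y \<in> W"
        using that q_in_W by auto
      consider "x \<in> A" | "x \<in> B"
        using q_arcs(1)[OF xy(1)] verts_eq in_arcsD1[of x y] not_T[of x y] by auto
      then show ?thesis
      proof cases
        case 1
        then show ?thesis
          using potential_A_le[OF assms(1)] xy q_arcs(1) Pair by auto
      next
        case 2
        then have "y = \<tau> x"
          using q_arcs(2)[OF xy(1)] xy(2) \<rho>_on \<rho>_off by metis
        then show ?thesis using 2 \<tau>(2) xy Pair by auto
      qed
    qed
    have "path_cost ?c p = sum ?c (set p)"
      using dist by (simp add: path_cost_def sum_list_distinct_conv_sum_set distinct_map)
    \<comment> \<open>Dropping the arcs of \<open>p\<close> outside \<open>q\<close> discards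
      nonpositive terms; the next step adds the nonnegative ones of \<open>q\<close>.\<close>
    also have "\<dots> \<le> sum ?c (set p \<inter> set q)"
      using p_le sum_mono2[of "set p" "set p \<inter> set q" "\<lambda>e. - ?c e"]
      by (simp add: sum_negf del: minus_diff_eq)
    also have "\<dots> \<le> sum ?c (set q)"
      using q_ge by (intro sum_mono2) auto
    also have "\<dots> = path_cost ?c q"
      using distq by (simp add: path_cost_def sum_list_distinct_conv_sum_set distinct_map)
    \<comment> \<open>Both paths start at \<open>s\<close> and end where \<open>d\<close> is 0, so
      the telescoping terms agree.\<close>
    finally show ?thesis
      using t t' assms(1) path_cost_telescope[of s p t r d] path_cost_telescope[of s q t' r d]
      by (auto simp: potential_def)
  qed
  then have "is_arg_min (path_cost r) (\<lambda>q. q \<in> ?Q) p"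
    using pQ by (simp add: is_arg_min_linorder)
  then have "Path p \<in> shortest_outcomes (restrict_to_strategy G B \<rho>) s T r"
    using pQ by (auto simp: shortest_outcomes_def)
  then have "Path p \<in> best_response_outcomes G s T B r"
    using \<rho> by (auto simp: best_response_outcomes_def)
  ultimately show ?thesis by blast
qed

text \<open>Under \<tau> the complement of \<open>W\<close> is a trap: nothing in it has an arc into
  \<open>W\<close>, which contains \<open>T\<close>.\<close>

lemma infinity_outcome:
  assumes "potential W d" "\<And>x. x \<in> pverts G - W \<Longrightarrow> \<not> ready W x" "s \<notin> W"
    and \<tau>: "\<tau> \<in> strategies G B" "\<And>x. x \<in> B \<Longrightarrow> x \<notin> W \<Longrightarrow> \<tau> x \<notin> W"
  shows "Infinity \<in> best_response_outcomes G s T B r"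
proof -
  have "q \<notin> paths_to (restrict_to_strategy G B \<tau>) s T" for q
  proof
    assume q: "q \<in> paths_to (restrict_to_strategy G B \<tau>) s T"
    then obtain t where t: "t \<in> T" "pcas s q t" by (auto simp: mem_paths_to_iff)
    have "t \<in> W" using t assms(1) by (auto simp: potential_def)
    have "s \<in> W"
    proof (rule conjunct1[OF pcas_closed_backwards[OF t(2) \<open>t \<in> W\<close>]])
      fix x y assume "(x, y) \<in> set q" "y \<in> W"
      then have xy: "(x, y) \<in> parcs G" "x \<in> B \<Longrightarrow> y = \<tau> x" "y \<in> W"
        using q by (auto simp: mem_paths_to_iff)
      show "x \<in> W"
        using assms(2)[of x] \<tau>(2)[of x] xy verts_eq in_arcsD1[of x y] terminal_no_arc[of x y]
        by (auto simp: ready_def)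
    qed
    then show False using assms(3) by simp
  qed
  then have "paths_to (restrict_to_strategy G B \<tau>) s T = {}" by blast
  then show ?thesis
    using \<tau>(1) by (auto simp: best_response_outcomes_def shortest_outcomes_def)
qed

lemma common_outcome_or_infinity:
  "best_response_outcomes G s T B r \<inter> best_response_outcomes G s T A r' \<noteq> {} \<or>
     Infinity \<in> best_response_outcomes G s T B r"
proof -
  obtain W d \<sigma> \<tau> where *: "potential W d"
    "\<And>x. x \<in> pverts G - W \<Longrightarrow> \<not> ready W x"
    "\<sigma> \<in> strategies G A" "\<tau> \<in> strategies G B"
    "\<And>x. x \<in> A \<Longrightarrow> x \<in> W \<Longrightarrow> \<sigma> x \<in> W \<and> d x = r (x, \<sigma> x) + d (\<sigma> x)"
    "\<And>x. x \<in> B \<Longrightarrow> x \<in> W \<Longrightarrow> \<tau> x \<in> W \<and> d x = r (x, \<tau> x) + d (\<tau> x)"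
    "\<And>x. x \<in> B \<Longrightarrow> x \<notin> W \<Longrightarrow> \<tau> x \<notin> W"
    using optimal_strategies_exist by blast
  show ?thesis
  proof (cases "s \<in> W")
    case True
    show ?thesis
      by (rule disjI1, rule terminal_common_outcome[OF *(1,2) True *(3,5,4,6,7)])
  next
    case False
    show ?thesis
      by (rule disjI2, rule infinity_outcome[OF *(1,2) False *(4,7)])
  qed
qed

end

theorem theorem3:
  fixes G :: "'a pair_pre_digraph"
    and s :: 'a
    and V1 V2 VT :: "'a set"
    and r1 r2 :: "'a \<times> 'a \<Rightarrow> real"
  assumes "pair_fin_digraph G"
    and "s \<in> pverts G"
    and "pverts G = V1 \<union> V2 \<union> VT"
    and "V1 \<inter> V2 = {}" and "V1 \<inter> VT = {}" and "V2 \<inter> VT = {}"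
    and "VT = {v \<in> pverts G. out_arcs (with_proj G) v = {}}"
    and "\<And>e. e \<in> parcs G \<Longrightarrow> r1 e > 0"
    and "\<And>e. e \<in> parcs G \<Longrightarrow> r2 e > 0"
  shows "best_response_outcomes G s VT V2 r1 \<inter> best_response_outcomes G s VT V1 r2 \<noteq> {}"
proof -
  have "cost_game G V1 V2 VT r1"
    by (intro cost_game.intro cost_game_axioms.intro assms)
  moreover have "cost_game G V2 V1 VT r2"
    by (intro cost_game.intro cost_game_axioms.intro assms(1,5,6,7,9))
      (use assms(3,4) in auto)
  \<comment> \<open>If neither assignment of the roles yields a common outcome directly,
    \<open>Infinity\<close> lies in both sets.\<close>
  ultimately show ?thesis
    using cost_game.common_outcome_or_infinity[of G V1 V2 VT r1 s r2]
      cost_game.common_outcome_or_infinity[of G V2 V1 VT r2 s r1] by blast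
qed

end
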